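(* Let $|\psi_{ABC}\rangle\in\mathbb{C}^2\otimes\mathbb{C}^2\otimes\mathbb{C}^2$ be a pure three-qubit state (a unit vector) with three-tangle $\tau$. For each $ij\in\{AB,BC,AC\}$, let $\mu_0^{ij}$ and $\mu_2^{ij}$ denote respectively the largest and the smallest eigenvalue of the $4\times4$ real matrix $\Gamma_{ij}$. Then $$\mu_0^{ij}-\mu_2^{ij}=\tau\qquad\text{for } ij=AB,\,BC,\,AC.$$ In particular, the difference is the same for all three pairs of qubits. If $|\psi_{ABC}\rangle=\lambda_0|0,0,0\rangle+\lambda_1e^{i\phi}|1,0,0\rangle+\lambda_2|1,0,1\rangle+\lambda_3|1,1,0\rangle+\lambda_4|1,1,1\rangle$ with real $\lambda_k\ge0$, $\sum_{k=0}^4\lambda_k^2=1$, $0\le\phi\le\pi$, this common value is $4\lambda_0^2\lambda_4^2$.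
   Context: Reduced states: $\rho_{AB}=\mathrm{Tr}_C|\psi_{ABC}\rangle\langle\psi_{ABC}|$, $\rho_{BC}=\mathrm{Tr}_A|\psi_{ABC}\rangle\langle\psi_{ABC}|$, $\rho_{AC}=\mathrm{Tr}_B|\psi_{ABC}\rangle\langle\psi_{ABC}|$. Let $\sigma_0=I_2$ and let $\sigma_1=\begin{pmatrix}0&1\\1&0\end{pmatrix}$, $\sigma_2=\begin{pmatrix}0&-i\\ i&0\end{pmatrix}$, $\sigma_3=\begin{pmatrix}1&0\\0&-1\end{pmatrix}$ be the Pauli matrices. For $ij\in\{AB,BC,AC\}$, $\Lambda_{ij}$ is the $4\times4$ real matrix with entries $(\Lambda_{ij})_{\alpha\beta}=\mathrm{Tr}[\rho_{ij}(\sigma_\alpha\otimes\sigma_\beta)]$, $\alpha,\beta=0,1,2,3$, and $\Gamma_{ij}=G\,\Lambda_{ij}\,G\,\Lambda_{ij}^T$ with $G=\mathrm{diag}(1,-1,-1,-1)$. The eigenvalues of $\Gamma_{ij}$ are real and non-negative. Three-tangle: write $|\psi_{ABC}\rangle=\sum_{i,j,k\in\{0,1\}}c_{ijk}|i,j,k\rangle$ in the computational basis (qubits ordered $A,B,C$). Let $\epsilon$ be the antisymmetric tensor with $\epsilon_{01}=-\epsilon_{10}=1$, $\epsilon_{00}=\epsilon_{11}=0$, and define $$I_5=\tfrac14\left|\sum \epsilon_{i_1i_2}\epsilon_{i_3i_4}\epsilon_{j_1j_2}\epsilon_{j_3j_4}\epsilon_{k_1k_3}\epsilon_{k_2k_4}\,c_{i_1j_1k_1}c_{i_2j_2k_2}c_{i_3j_3k_3}c_{i_4j_4k_4}\right|^2,$$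 the sum running over all indices in $\{0,1\}$. The three-tangle $\tau\ge0$ is defined by $I_5=\tau^2/16$, i.e. $\tau=4\sqrt{I_5}$. *)

theory Defs
  imports "HOL-Analysis.Analysis"
begin

text \<open>
  The type \<^typ>\<open>2\<close> with elements 0 and 1 indexes the computational basis of a qubit, and
  the type \<^typ>\<open>4\<close> with elements 0, 1, 2, 3 indexes the Pauli matrices. Numerals are taken
  modulo the size of the type (in \<^typ>\<open>2\<close>, 2 = 0), so only these representatives are used.
  Tensor products are modelled by product index types: the amplitude \<open>c\<^sub>i\<^sub>j\<^sub>k\<close> of
  \<open>\<psi>\<close> is \<open>\<psi> $ (i, j, k)\<close>, with the qubits ordered A, B, C.
\<close>

type_synonym three_qubit = "complex ^ (2 \<times> 2 \<times> 2)"
type_synonym one_qubit_op = "complex ^ 2 ^ 2"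
type_synonym two_qubit_op = "complex ^ (2 \<times> 2) ^ (2 \<times> 2)"
type_synonym three_qubit_op = "complex ^ (2 \<times> 2 \<times> 2) ^ (2 \<times> 2 \<times> 2)"

definition ket :: "2 \<Rightarrow> 2 \<Rightarrow> 2 \<Rightarrow> three_qubit" where
  "ket i j k = axis (i, j, k) 1"

definition density :: "three_qubit \<Rightarrow> three_qubit_op" where
  "density \<psi> = (\<chi> x y. \<psi> $ x * cnj (\<psi> $ y))"

definition ptrace_A :: "three_qubit_op \<Rightarrow> two_qubit_op" where
  "ptrace_A R = (\<chi> x y. \<Sum>i\<in>UNIV. R $ (i, fst x, snd x) $ (i, fst y, snd y))"

definition ptrace_B :: "three_qubit_op \<Rightarrow> two_qubit_op" where
  "ptrace_B R = (\<chi> x y. \<Sum>j\<in>UNIV. R $ (fst x, j, snd x) $ (fst y, j, snd y))"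

definition ptrace_C :: "three_qubit_op \<Rightarrow> two_qubit_op" where
  "ptrace_C R = (\<chi> x y. \<Sum>k\<in>UNIV. R $ (fst x, snd x, k) $ (fst y, snd y, k))"

datatype qubit_pair = AB | BC | AC

fun reduced_state :: "qubit_pair \<Rightarrow> three_qubit \<Rightarrow> two_qubit_op" where
  "reduced_state AB \<psi> = ptrace_C (density \<psi>)"
| "reduced_state BC \<psi> = ptrace_A (density \<psi>)"
| "reduced_state AC \<psi> = ptrace_B (density \<psi>)"

definition mat2 :: "complex \<Rightarrow> complex \<Rightarrow> complex \<Rightarrow> complex \<Rightarrow> one_qubit_op" where
  "mat2 a b c d =
     (\<chi> i j. if i = 0 then (if j = 0 then a else b) else (if j = 0 then c else d))"

definition pauli :: "4 \<Rightarrow> one_qubit_op" where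
  "pauli \<alpha> =
     (if \<alpha> = 0 then mat 1
      else if \<alpha> = 1 then mat2 0 1 1 0
      else if \<alpha> = 2 then mat2 0 (- \<i>) \<i> 0
      else mat2 1 0 0 (- 1))"

definition kron :: "one_qubit_op \<Rightarrow> one_qubit_op \<Rightarrow> two_qubit_op" where
  "kron P Q = (\<chi> x y. P $ fst x $ fst y * Q $ snd x $ snd y)"

text \<open>
  The trace below is a real number, since both factors are Hermitian
  (lemma \<open>Lambda_trace_real\<close>), so that taking the real part loses nothing.
\<close>

definition Lambda :: "qubit_pair \<Rightarrow> three_qubit \<Rightarrow> real ^ 4 ^ 4" where
  "Lambda p \<psi> =
     (\<chi> \<alpha> \<beta>. Re (trace (reduced_state p \<psi> ** kron (pauli \<alpha>) (pauli \<beta>))))"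

definition G :: "real ^ 4 ^ 4" where
  "G = (\<chi> \<alpha> \<beta>. if \<alpha> = \<beta> then (if \<alpha> = 0 then 1 else - 1) else 0)"

definition Gamma :: "qubit_pair \<Rightarrow> three_qubit \<Rightarrow> real ^ 4 ^ 4" where
  "Gamma p \<psi> = G ** Lambda p \<psi> ** G ** transpose (Lambda p \<psi>)"

definition eigenvalues :: "'a::field ^ 'n ^ 'n \<Rightarrow> 'a set" where
  "eigenvalues A = {\<mu>. \<exists>v. v \<noteq> 0 \<and> A *v v = \<mu> *s v}"

text \<open>
  The eigenvalues of the real matrix \<open>Gamma p \<psi>\<close> are all real (and non-negative), so its real
  eigenvalues are all of them.
\<close>

definition mu0 :: "qubit_pair \<Rightarrow> three_qubit \<Rightarrow> real" where
  "mu0 p \<psi> = Max (eigenvalues (Gamma p \<psi>))"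

definition mu2 :: "qubit_pair \<Rightarrow> three_qubit \<Rightarrow> real" where
  "mu2 p \<psi> = Min (eigenvalues (Gamma p \<psi>))"

definition eps :: "2 \<Rightarrow> 2 \<Rightarrow> complex" where
  "eps i j = (if i = 0 \<and> j = 1 then 1 else if i = 1 \<and> j = 0 then - 1 else 0)"

definition I5 :: "three_qubit \<Rightarrow> real" where
  "I5 \<psi> = 1 / 4 * (cmod
     (\<Sum>i1\<in>UNIV. \<Sum>i2\<in>UNIV. \<Sum>i3\<in>UNIV. \<Sum>i4\<in>UNIV.
      \<Sum>j1\<in>UNIV. \<Sum>j2\<in>UNIV. \<Sum>j3\<in>UNIV. \<Sum>j4\<in>UNIV.
      \<Sum>k1\<in>UNIV. \<Sum>k2\<in>UNIV. \<Sum>k3\<in>UNIV. \<Sum>k4\<in>UNIV.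
        eps i1 i2 * eps i3 i4 * eps j1 j2 * eps j3 j4 * eps k1 k3 * eps k2 k4 *
        \<psi> $ (i1, j1, k1) * \<psi> $ (i2, j2, k2) * \<psi> $ (i3, j3, k3) * \<psi> $ (i4, j4, k4)))\<^sup>2"

definition three_tangle :: "three_qubit \<Rightarrow> real" where
  "three_tangle \<psi> = 4 * sqrt (I5 \<psi>)"

lemma reduced_state_hermitian:
  "cnj (reduced_state p \<psi> $ x $ y) = reduced_state p \<psi> $ y $ x"
  by (cases p) (simp_all add: ptrace_A_def ptrace_B_def ptrace_C_def density_def mult.commute)

lemma pauli_hermitian: "cnj (pauli \<alpha> $ i $ j) = pauli \<alpha> $ j $ i"
  by (cases i rule: bit0_cases; cases j rule: bit0_cases) (auto simp: pauli_def mat2_def mat_def)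

lemma Lambda_trace_real:
  "trace (reduced_state p \<psi> ** kron (pauli \<alpha>) (pauli \<beta>)) \<in> \<real>"
proof -
  have "cnj (trace (reduced_state p \<psi> ** kron (pauli \<alpha>) (pauli \<beta>))) =
      (\<Sum>x\<in>UNIV. \<Sum>y\<in>UNIV. reduced_state p \<psi> $ y $ x * kron (pauli \<alpha>) (pauli \<beta>) $ x $ y)"
    by (simp add: trace_def matrix_matrix_mult_def kron_def reduced_state_hermitian pauli_hermitian)
  also have "\<dots> = trace (reduced_state p \<psi> ** kron (pauli \<alpha>) (pauli \<beta>))"
    unfolding trace_def matrix_matrix_mult_def by (subst sum.swap) simp
  finally show ?thesis
    by (simp add: complex_eq_iff complex_is_Real_iff)
qed

end

theory Submission
  imports Defs
begin

text \<open>
  Write a real 4-vector \<open>v\<close> as the Hermitian matrix \<open>X = \<Sum>\<^sub>\<alpha> v\<^sub>\<alpha> \<sigma>\<^sub>\<alpha>\<close>, and the amplitudes as two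
  2x2 matrices \<open>A\<close>, \<open>B\<close>, one for each basis state of the qubit that is traced out. Up to
  transposition, \<open>\<Lambda>\<close> and its transpose become the completely positive maps with Kraus operators
  \<open>A\<close>, \<open>B\<close> and their adjoints, while \<open>G\<close> becomes the adjugate. Hence \<open>\<Gamma>\<close> is four times the map with
  Kraus operators \<open>A adj A\<close>, \<open>B adj B\<close>, \<open>A adj B\<close>, \<open>B adj A\<close>. The first two are scalar, and the
  last two are \<open>t/2 + N\<close> and \<open>t/2 - N\<close> with \<open>N\<close> traceless and \<open>N\<^sup>2 = D/4\<close>, where \<open>D\<close> is
  Cayley's hyperdeterminant. Therefore \<open>\<Gamma> X = s X + 8 N\<^sup>* X N\<close>; the second summand squares to
  \<open>(2 |D|)\<^sup>2\<close> and is not a nonzero scalar, so the eigenvalues are \<open>s + 2 |D|\<close> and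
  \<open>s - 2 |D|\<close>. Their difference \<open>4 |D|\<close> is the three-tangle, since \<open>D\<close> does not depend on which
  qubit is traced out.
\<close>

section \<open>Finite index types and Pauli entries\<close>

lemma two_eq_0: "(2 :: 2) = 0" and four_eq_0: "(4 :: 4) = 0"
  by simp_all

text \<open>The library enumerates type \<open>2\<close> as 1, 2 and type \<open>4\<close> as 1,
  ..., 4; these variants restore the representative 0 in place of 2 or 4.\<close>

lemma sum_2': "sum f (UNIV :: 2 set) = f 0 + f 1"
  using sum_2[of f] unfolding two_eq_0 by (simp only: add.commute)

lemma forall_2': "(\<forall>i::2. P i) \<longleftrightarrow> P 0 \<and> P 1"
  using forall_2[of P] unfolding two_eq_0 by (simp only: conj_commute)

lemma sum_4': "sum f (UNIV :: 4 set) = f 0 + f 1 + f 2 + f 3"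
  using sum_4[of f] unfolding four_eq_0 by (simp only: ac_simps)

lemma forall_4': "(\<forall>i::4. P i) \<longleftrightarrow> P 0 \<and> P 1 \<and> P 2 \<and> P 3"
  using forall_4[of P] unfolding four_eq_0 by (simp only: conj_ac)

lemma sum_2_times_2: "sum f (UNIV :: (2 \<times> 2) set) = f (0, 0) + f (0, 1) + f (1, 0) + f (1, 1)"
proof -
  have "sum f (UNIV :: (2 \<times> 2) set) = (\<Sum>i\<in>UNIV. \<Sum>j\<in>UNIV. f (i, j))"
    by (simp add: sum.cartesian_product)
  then show ?thesis by (simp add: sum_2' add.assoc)
qed

lemma pauli_entries:
  "pauli 0 $ i $ j = (if i = j then 1 else 0)"
  "pauli 1 $ i $ j = (if i = j then 0 else 1)"
  "pauli 2 $ i $ j = (if i = j then 0 else if i = 0 then - \<i> else \<i>)"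
  "pauli 3 $ i $ j = (if i = j then if i = 0 then 1 else - 1 else 0)"
  using forall_2'[of "\<lambda>i. i = 0 \<or> i = 1"] by (auto simp: pauli_def mat2_def mat_def)

lemma mat2_entries [simp]:
  "mat2 a b c d $ 0 $ 0 = a" "mat2 a b c d $ 0 $ 1 = b"
  "mat2 a b c d $ 1 $ 0 = c" "mat2 a b c d $ 1 $ 1 = d"
  by (simp_all add: mat2_def)

section \<open>Adjugate and adjoint of 2x2 matrices\<close>

definition adj2 :: "one_qubit_op \<Rightarrow> one_qubit_op" where
  "adj2 A = mat2 (A $ 1 $ 1) (- A $ 0 $ 1) (- A $ 1 $ 0) (A $ 0 $ 0)"

definition dagger :: "one_qubit_op \<Rightarrow> one_qubit_op" where
  "dagger A = (\<chi> i j. cnj (A $ j $ i))"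

definition det2 :: "one_qubit_op \<Rightarrow> complex" where
  "det2 A = A $ 0 $ 0 * A $ 1 $ 1 - A $ 0 $ 1 * A $ 1 $ 0"

lemmas entries2 = vec_eq_iff forall_2' matrix_matrix_mult_def sum_2' adj2_def dagger_def
  transpose_def mat_def

lemma adj2_mult: "adj2 (A ** B) = adj2 B ** adj2 A"
  by (simp add: entries2 algebra_simps)

lemma adj2_adj2 [simp]: "adj2 (adj2 A) = A"
  by (simp add: entries2)

lemma adj2_add: "adj2 (A + B) = adj2 A + adj2 B"
  by (simp add: entries2)

lemma adj2_scaleR: "adj2 (r *\<^sub>R A) = r *\<^sub>R adj2 A"
  by (simp add: entries2)

lemma adj2_dagger: "adj2 (dagger A) = dagger (adj2 A)"
  by (simp add: entries2)

lemma dagger_mult: "dagger (A ** B) = dagger B ** dagger A"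
  by (simp add: entries2 algebra_simps)

lemma adj2_transpose: "adj2 (transpose A) = transpose (adj2 A)"
  by (simp add: entries2)

section \<open>Real 4-vectors as Hermitian matrices\<close>

definition herm :: "real ^ 4 \<Rightarrow> one_qubit_op" where
  "herm v = (\<Sum>\<alpha>\<in>UNIV. (v $ \<alpha>) *\<^sub>R pauli \<alpha>)"

lemma herm_entry: "herm v $ i $ j = (\<Sum>\<alpha>\<in>UNIV. complex_of_real (v $ \<alpha>) * pauli \<alpha> $ i $ j)"
  by (simp add: herm_def scaleR_conv_of_real[where 'a = complex])

lemma herm_entries:
  "herm v $ 0 $ 0 = complex_of_real (v $ 0 + v $ 3)"
  "herm v $ 0 $ 1 = Complex (v $ 1) (- (v $ 2))"
  "herm v $ 1 $ 0 = Complex (v $ 1) (v $ 2)"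
  "herm v $ 1 $ 1 = complex_of_real (v $ 0 - v $ 3)"
  by (simp_all add: herm_entry sum_4' pauli_entries complex_eq_iff)

lemma herm_inject: "herm v = herm w \<longleftrightarrow> v = w"
proof
  assume "herm v = herm w"
  then have "herm v $ 0 $ 0 = herm w $ 0 $ 0" "herm v $ 0 $ 1 = herm w $ 0 $ 1"
    "herm v $ 1 $ 1 = herm w $ 1 $ 1"
    by simp_all
  then show "v = w"
    unfolding herm_entries by (auto simp: vec_eq_iff forall_4' complex_eq_iff)
qed simp

lemma herm_scaleR: "herm (r *\<^sub>R v) = r *\<^sub>R herm v"
  by (simp add: herm_def scaleR_sum_right)

lemma herm_diff: "herm (v - w) = herm v - herm w"
  by (simp add: herm_def scaleR_left_diff_distrib sum_subtractf)

text \<open>Reversing the three Pauli coefficients turns v0 + v.sigma into v0 - v.sigma, which is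
  its adjugate.\<close>

lemma herm_G: "herm (G *v v) = adj2 (herm v)"
  by (simp add: vec_eq_iff forall_2' adj2_def herm_entries complex_eq_iff G_def
      matrix_vector_mult_def sum_4')

section \<open>\<open>Lambda\<close> and its transpose as Kraus maps\<close>

definition pair_state :: "(2 \<Rightarrow> one_qubit_op) \<Rightarrow> two_qubit_op" where
  "pair_state M = (\<chi> x y. \<Sum>k\<in>UNIV. M k $ fst x $ snd x * cnj (M k $ fst y $ snd y))"

text \<open>The index \<open>k\<close> belongs to the traced-out qubit; rows and columns belong to
  the first and second qubit of the pair.\<close>

fun slice :: "qubit_pair \<Rightarrow> three_qubit \<Rightarrow> 2 \<Rightarrow> one_qubit_op" where
  "slice AB \<psi> k = (\<chi> i j. \<psi> $ (i, j, k))"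
| "slice BC \<psi> k = (\<chi> i j. \<psi> $ (k, i, j))"
| "slice AC \<psi> k = (\<chi> i j. \<psi> $ (i, k, j))"

lemma reduced_state_eq: "reduced_state p \<psi> = pair_state (slice p \<psi>)"
  by (cases p) (simp_all add: pair_state_def ptrace_A_def ptrace_B_def ptrace_C_def density_def)

lemma of_real_Lambda:
  "complex_of_real (Lambda p \<psi> $ \<alpha> $ \<beta>) =
    (\<Sum>x\<in>UNIV. \<Sum>y\<in>UNIV. reduced_state p \<psi> $ x $ y *
      (pauli \<alpha> $ fst y $ fst x * pauli \<beta> $ snd y $ snd x))"
proof -
  have "complex_of_real (Lambda p \<psi> $ \<alpha> $ \<beta>) =
      trace (reduced_state p \<psi> ** kron (pauli \<alpha>) (pauli \<beta>))"
    using Lambda_trace_real[of p \<psi> \<alpha> \<beta>] by (simp add: Lambda_def)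
  then show ?thesis
    by (simp add: trace_def matrix_matrix_mult_def kron_def)
qed

text \<open>Pauli completeness, sum_\<alpha> Tr(\<sigma>_\<alpha> Y) \<sigma>_\<alpha> = 2 Y,
  applied to the partial trace Y = Tr_2[\<rho> (1 \<otimes> X)] with X = \<open>herm v\<close>. The
  transpose comes from reading the amplitudes as a matrix.\<close>

lemma herm_Lambda:
  "herm (Lambda p \<psi> *v v) =
    2 *\<^sub>R (\<Sum>k\<in>UNIV. slice p \<psi> k ** transpose (herm v) ** dagger (slice p \<psi> k))"
proof -
  define R where "R = reduced_state p \<psi>"
  have 1: "complex_of_real ((Lambda p \<psi> *v v) $ \<alpha>) =
      (\<Sum>x\<in>UNIV. \<Sum>y\<in>UNIV. R $ x $ y * (pauli \<alpha> $ fst y $ fst x * herm v $ snd y $ snd x))" for \<alpha>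
  proof -
    have "complex_of_real ((Lambda p \<psi> *v v) $ \<alpha>) = (\<Sum>\<beta>\<in>UNIV. \<Sum>x\<in>UNIV. \<Sum>y\<in>UNIV.
      R $ x $ y * (pauli \<alpha> $ fst y $ fst x * pauli \<beta> $ snd y $ snd x) * complex_of_real (v $ \<beta>))"
      by (simp add: matrix_vector_mult_def of_real_Lambda sum_distrib_right R_def)
    also have "\<dots> = (\<Sum>x\<in>UNIV. \<Sum>y\<in>UNIV. \<Sum>\<beta>\<in>UNIV.
      R $ x $ y * (pauli \<alpha> $ fst y $ fst x * pauli \<beta> $ snd y $ snd x) * complex_of_real (v $ \<beta>))"
      by (subst sum.swap, rule sum.cong[OF refl], subst sum.swap, rule refl)
    finally show ?thesis
      by (simp add: herm_entry sum_distrib_left mult_ac)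
  qed
  have "herm (Lambda p \<psi> *v v) $ i $ j =
    2 * (\<Sum>a\<in>UNIV. \<Sum>b\<in>UNIV. R $ (i, a) $ (j, b) * herm v $ b $ a)" for i j
  proof -
    have "\<forall>i j. herm (Lambda p \<psi> *v v) $ i $ j =
      2 * (\<Sum>a\<in>UNIV. \<Sum>b\<in>UNIV. R $ (i, a) $ (j, b) * herm v $ b $ a)"
      unfolding herm_entry[of "Lambda p \<psi> *v v"] 1
      by (simp add: forall_2' sum_4' pauli_entries sum_2_times_2 sum_2' algebra_simps)
    then show ?thesis by blast
  qed
  then show ?thesis
    unfolding R_def reduced_state_eq
    by (simp add: entries2 pair_state_def scaleR_conv_of_real[where 'a = complex] algebra_simps)
qed

text \<open>The same completeness argument with the first qubit of the pair contracted instead of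
  the second.\<close>

lemma herm_transpose_Lambda:
  "herm (transpose (Lambda p \<psi>) *v v) =
    2 *\<^sub>R transpose (\<Sum>k\<in>UNIV. dagger (slice p \<psi> k) ** herm v ** slice p \<psi> k)"
proof -
  define R where "R = reduced_state p \<psi>"
  have 1: "complex_of_real ((transpose (Lambda p \<psi>) *v v) $ \<beta>) =
      (\<Sum>x\<in>UNIV. \<Sum>y\<in>UNIV. R $ x $ y * (herm v $ fst y $ fst x * pauli \<beta> $ snd y $ snd x))" for \<beta>
  proof -
    have "complex_of_real ((transpose (Lambda p \<psi>) *v v) $ \<beta>) = (\<Sum>\<alpha>\<in>UNIV. \<Sum>x\<in>UNIV. \<Sum>y\<in>UNIV.
      R $ x $ y * (pauli \<alpha> $ fst y $ fst x * pauli \<beta> $ snd y $ snd x) * complex_of_real (v $ \<alpha>))"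
      by (simp add: matrix_vector_mult_def of_real_Lambda sum_distrib_right R_def transpose_def)
    also have "\<dots> = (\<Sum>x\<in>UNIV. \<Sum>y\<in>UNIV. \<Sum>\<alpha>\<in>UNIV.
      R $ x $ y * (pauli \<alpha> $ fst y $ fst x * pauli \<beta> $ snd y $ snd x) * complex_of_real (v $ \<alpha>))"
      by (subst sum.swap, rule sum.cong[OF refl], subst sum.swap, rule refl)
    finally show ?thesis
      by (simp add: herm_entry sum_distrib_left sum_distrib_right mult_ac)
  qed
  have "herm (transpose (Lambda p \<psi>) *v v) $ i $ j =
    2 * (\<Sum>a\<in>UNIV. \<Sum>b\<in>UNIV. R $ (a, i) $ (b, j) * herm v $ b $ a)" for i j
  proof -
    have "\<forall>i j. herm (transpose (Lambda p \<psi>) *v v) $ i $ j =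
      2 * (\<Sum>a\<in>UNIV. \<Sum>b\<in>UNIV. R $ (a, i) $ (b, j) * herm v $ b $ a)"
      unfolding herm_entry[of "transpose (Lambda p \<psi>) *v v"] 1
      by (simp add: forall_2' sum_4' pauli_entries sum_2_times_2 sum_2' algebra_simps)
    then show ?thesis by blast
  qed
  then show ?thesis
    unfolding R_def reduced_state_eq
    by (simp add: entries2 pair_state_def scaleR_conv_of_real[where 'a = complex] algebra_simps)
qed

section \<open>Scalar and traceless parts of \<open>A ** adj2 B\<close>\<close>

lemma matrix_add_rdistrib: "(A + B) ** C = A ** C + B ** (C :: 'a::semiring_1 ^ 'n ^ 'm)"
  by (simp add: vec_eq_iff matrix_matrix_mult_def sum.distrib distrib_right)

lemma mult_adj2: "A ** adj2 A = mat (det2 A)"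
  by (simp add: entries2 det2_def algebra_simps)

text \<open>Since \<open>B ** adj2 A\<close> is the adjugate of \<open>A ** adj2 B\<close>, this is
  the traceless part of the latter.\<close>

definition skew :: "one_qubit_op \<Rightarrow> one_qubit_op \<Rightarrow> one_qubit_op" where
  "skew A B = (1 / 2) *\<^sub>R (A ** adj2 B - B ** adj2 A)"

text \<open>The polarisation of \<open>det2\<close>: \<open>polar A A = 2 * det2 A\<close>.\<close>

definition polar :: "one_qubit_op \<Rightarrow> one_qubit_op \<Rightarrow> complex" where
  "polar A B = A $ 0 $ 0 * B $ 1 $ 1 + A $ 1 $ 1 * B $ 0 $ 0 - A $ 0 $ 1 * B $ 1 $ 0 - A $ 1 $ 0 * B $ 0 $ 1"

text \<open>The discriminant of the binary quadratic form det(x A + y B).\<close>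

definition hyperdet :: "one_qubit_op \<Rightarrow> one_qubit_op \<Rightarrow> complex" where
  "hyperdet A B = (polar A B)\<^sup>2 - 4 * det2 A * det2 B"

lemma mult_adj2_skew: "A ** adj2 B = mat (polar A B / 2) + skew A B"
  by (simp add: entries2 polar_def skew_def scaleR_conv_of_real[where 'a = complex] field_simps)

lemma polar_commute: "polar A B = polar B A"
  by (simp add: polar_def)

lemma skew_commute: "skew A B = - skew B A"
  by (simp add: skew_def algebra_simps)

text \<open>By Cayley-Hamilton, a traceless N satisfies N^2 = -det N, and det(A adj B) = det A det B
  = t^2/4 + det N with t = \<open>polar A B\<close>.\<close>

lemma skew_square: "skew A B ** skew A B = mat (hyperdet A B / 4)"
  by (simp add: entries2 polar_def skew_def det2_def hyperdet_def scaleR_conv_of_real[where 'a = complex] field_simps power2_eq_square)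

lemma skew_trace: "skew A B $ 1 $ 1 = - skew A B $ 0 $ 0"
  by (simp add: entries2 skew_def scaleR_conv_of_real[where 'a = complex] field_simps)

lemma of_real_cmod_square: "(complex_of_real (cmod z))\<^sup>2 = z * cnj z"
  using complex_norm_square[of z] by simp

lemma dagger_mat_mult: "dagger (mat c) ** (X :: one_qubit_op) ** mat c = (cmod c)\<^sup>2 *\<^sub>R X"
  by (simp add: entries2 scaleR_conv_of_real[where 'a = complex] of_real_cmod_square mult_ac)

lemma parallelogram:
  "dagger (mat c + A) ** X ** (mat c + A) + dagger (mat c - A) ** X ** (mat c - A) =
    (2 * (cmod c)\<^sup>2) *\<^sub>R X + 2 *\<^sub>R (dagger A ** X ** A)"
  by (simp add: entries2 scaleR_conv_of_real[where 'a = complex] of_real_cmod_square algebra_simps)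

section \<open>Action and spectrum of \<open>Gamma\<close>\<close>

definition center :: "one_qubit_op \<Rightarrow> one_qubit_op \<Rightarrow> real" where
  "center A B = 4 * (cmod (det2 A))\<^sup>2 + 4 * (cmod (det2 B))\<^sup>2 + 2 * (cmod (polar A B))\<^sup>2"

lemma herm_Gamma:
  fixes v :: "real ^ 4" and \<psi> :: three_qubit and p :: qubit_pair
  defines "A \<equiv> slice p \<psi> 0" and "B \<equiv> slice p \<psi> 1"
  shows "herm (Gamma p \<psi> *v v) =
    center A B *\<^sub>R herm v + 8 *\<^sub>R (dagger (skew A B) ** herm v ** skew A B)"
proof -
  define X where "X = herm v"
  define Q where "Q C D = dagger (C ** adj2 D) ** X ** (C ** adj2 D)" for C D
  have "herm (Gamma p \<psi> *v v) = 4 *\<^sub>R adj2 (\<Sum>l\<in>UNIV. slice p \<psi> l **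
     adj2 (\<Sum>k\<in>UNIV. dagger (slice p \<psi> k) ** X ** slice p \<psi> k) ** dagger (slice p \<psi> l))"
    by (simp add: Gamma_def matrix_vector_mul_assoc[symmetric] herm_G herm_Lambda
       herm_transpose_Lambda X_def adj2_scaleR adj2_transpose transpose_scalar sum_2'
       matrix_scalar_ac scalar_matrix_assoc[symmetric] scaleR_add_right[symmetric] del: scaleR_add_right transpose_matrix_vector)
  \<comment> \<open>The transposes from the two \<open>Lambda\<close> maps have cancelled. The outer
    adjugate reverses products and undoes the inner one, leaving Kraus operators
    \<open>C ** adj2 D\<close>.\<close>
  also have "\<dots> = 4 *\<^sub>R (Q A A + Q B B + (Q A B + Q B A))"
    by (simp add: sum_2' adj2_add adj2_mult adj2_dagger A_def B_def Q_def dagger_mult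
      matrix_mul_assoc matrix_add_ldistrib matrix_add_rdistrib algebra_simps)
  also have "Q A B + Q B A = (2 * (cmod (polar A B / 2))\<^sup>2) *\<^sub>R X + 2 *\<^sub>R (dagger (skew A B) ** X ** skew A B)"
    using parallelogram[of "polar A B / 2" "skew A B" X]
    by (simp add: Q_def mult_adj2_skew polar_commute[of B A] skew_commute[of B A])
  \<comment> \<open>The scalar operators contribute 4 |det|^2 each and the cross pair 4 * 2 |t/2|^2,
    adding up to \<open>center A B\<close>.\<close>
  finally show ?thesis
    by (simp add: Q_def mult_adj2 dagger_mat_mult center_def X_def norm_divide power_divide
       algebra_simps flip: scaleR_add_left)
qed

text \<open>As (K - \<kappa>)(K + \<kappa>) = 0, either factor maps any vector it does not kill to
  an eigenvector for the opposite sign. \<open>nonscalar\<close> ensures that both signs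
  occur.\<close>

lemma eigenvalues_shifted_involution:
  fixes A :: "real ^ 'n ^ 'n"
  defines "K \<equiv> \<lambda>s v. A *v v - s *\<^sub>R v"
  assumes sq: "\<And>v. K s (K s v) = \<kappa>\<^sup>2 *\<^sub>R v"
    and nonscalar: "\<And>c. (\<And>v. K s v = c *\<^sub>R v) \<Longrightarrow> c = 0"
  shows "eigenvalues A = {s + \<kappa>, s - \<kappa>}"
proof (intro equalityI subsetI)
  fix \<mu> assume "\<mu> \<in> eigenvalues A"
  then obtain v where v: "v \<noteq> 0" "A *v v = \<mu> *\<^sub>R v"
    by (auto simp: eigenvalues_def scalar_mult_eq_scaleR)
  have "K s (t *\<^sub>R v) = (t * (\<mu> - s)) *\<^sub>R v" for t
    using v by (simp add: K_def matrix_vector_mult_scaleR scaleR_diff_left right_diff_distrib mult.commute)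
  from this[of 1] this[of "\<mu> - s"] have "K s (K s v) = (\<mu> - s)\<^sup>2 *\<^sub>R v"
    by (simp add: power2_eq_square)
  with sq v have "(\<mu> - s)\<^sup>2 = \<kappa>\<^sup>2"
    by (metis scaleR_cancel_right)
  then show "\<mu> \<in> {s + \<kappa>, s - \<kappa>}"
    by (auto simp: power2_eq_iff)
next
  have *: "s - c \<in> eigenvalues A" if c: "c\<^sup>2 = \<kappa>\<^sup>2" for c
  proof (cases "\<forall>v. K s v = c *\<^sub>R v")
    case True
    \<comment> \<open>Here K itself vanishes, so every nonzero vector has eigenvalue s.\<close>
    with nonscalar have "c = 0" by blast
    obtain v :: "real ^ 'n" where "v \<noteq> 0"
      using one_neq_zero by blast
    with True \<open>c = 0\<close> show ?thesis
      by (auto simp: eigenvalues_def K_def scalar_mult_eq_scaleR)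
  next
    case False
    then obtain v where v: "K s v - c *\<^sub>R v \<noteq> 0" by auto
    define w where "w = K s v - c *\<^sub>R v"
    have "K s w = K s (K s v) - c *\<^sub>R K s v"
      by (simp add: w_def K_def matrix_vector_mult_diff_distrib matrix_vector_mult_scaleR
          algebra_simps)
    also have "\<dots> = - c *\<^sub>R w"
      using c by (simp add: w_def sq power2_eq_square algebra_simps)
    finally have "A *v w = (s - c) *\<^sub>R w"
      by (simp add: K_def algebra_simps)
    moreover from v have "w \<noteq> 0" by (simp add: w_def)
    ultimately show ?thesis
      by (auto simp: eigenvalues_def scalar_mult_eq_scaleR)
  qed
  fix \<mu> assume "\<mu> \<in> {s + \<kappa>, s - \<kappa>}"
  with *[of \<kappa>] *[of "- \<kappa>"] show "\<mu> \<in> eigenvalues A" by auto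
qed

text \<open>The two basis projectors force N to be diagonal with |N_00|^2 = c; then \<sigma>_1
  forces -|N_00|^2 = c.\<close>

lemma traceless_conjugation_nonscalar:
  assumes tr: "N $ 1 $ 1 = - N $ 0 $ 0"
    and eq: "\<And>v. dagger N ** herm v ** N = c *\<^sub>R herm v"
  shows "c = 0"
proof -
  note e = vec_eq_iff forall_2' matrix_matrix_mult_def sum_2' dagger_def herm_entries Complex_eq
    scaleR_conv_of_real[where 'a = complex]
  have 1: "cnj (N $ 0 $ 0) * N $ 0 $ 0 = of_real c" "N $ 0 $ 1 = 0"
    using eq[of "\<chi> i. if i = 0 \<or> i = 3 then 1/2 else 0"]
    by (simp_all add: e)
  have "N $ 1 $ 0 = 0"
    using eq[of "\<chi> i. if i = 0 then 1/2 else if i = 3 then -1/2 else 0"]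
    by (simp add: e)
  with eq[of "\<chi> i. if i = 1 then 1 else 0"] 1 tr
  have "- (cnj (N $ 0 $ 0) * N $ 0 $ 0) = of_real c"
    by (simp add: e)
  with 1 show ?thesis by simp
qed

lemma eigenvalues_Gamma:
  fixes \<psi> :: three_qubit and p :: qubit_pair
  defines "A \<equiv> slice p \<psi> 0" and "B \<equiv> slice p \<psi> 1"
  shows "eigenvalues (Gamma p \<psi>) =
    {center A B + 2 * cmod (hyperdet A B), center A B - 2 * cmod (hyperdet A B)}"
proof (rule eigenvalues_shifted_involution)
  let ?N = "skew A B"
  define K where "K v = Gamma p \<psi> *v v - center A B *\<^sub>R v" for v
  have K: "herm (K v) = 8 *\<^sub>R (dagger ?N ** herm v ** ?N)" for v
    using herm_Gamma[of p \<psi> v] by (simp add: K_def A_def B_def herm_diff herm_scaleR)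
  fix v
  have "herm (K (K v)) = 64 *\<^sub>R (dagger (?N ** ?N) ** herm v ** (?N ** ?N))"
    by (simp add: K matrix_mul_assoc dagger_mult matrix_scalar_ac scalar_matrix_assoc[symmetric])
  \<comment> \<open>N^2 is the scalar D/4, with D = \<open>hyperdet A B\<close>, and 64 |D/4|^2 = (2
    |D|)^2.\<close>
  also have "\<dots> = herm ((2 * cmod (hyperdet A B))\<^sup>2 *\<^sub>R v)"
    by (simp add: skew_square dagger_mat_mult herm_scaleR norm_divide power_divide power_mult_distrib)
  finally show "Gamma p \<psi> *v (Gamma p \<psi> *v v - center A B *\<^sub>R v) -
      center A B *\<^sub>R (Gamma p \<psi> *v v - center A B *\<^sub>R v) = (2 * cmod (hyperdet A B))\<^sup>2 *\<^sub>R v"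
    by (simp add: herm_inject K_def)
next
  fix c assume c: "\<And>v. Gamma p \<psi> *v v - center A B *\<^sub>R v = c *\<^sub>R v"
  have "dagger (skew A B) ** herm v ** skew A B = (c / 8) *\<^sub>R herm v" for v
  proof -
    have "8 *\<^sub>R (dagger (skew A B) ** herm v ** skew A B) = c *\<^sub>R herm v"
      using herm_Gamma[of p \<psi> v] arg_cong[OF c[of v], of herm]
      by (simp add: A_def B_def herm_diff herm_scaleR)
    from arg_cong[OF this, of "\<lambda>X. (1 / 8) *\<^sub>R X"] show ?thesis by simp
  qed
  from traceless_conjugation_nonscalar[OF skew_trace this] show "c = 0" by simp
qed

section \<open>Hyperdeterminant and three-tangle\<close>

lemma hyperdet_slice: "hyperdet (slice p \<psi> 0) (slice p \<psi> 1) = hyperdet (slice AB \<psi> 0) (slice AB \<psi> 1)"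
  by (cases p) (simp_all add: hyperdet_def polar_def det2_def power2_eq_square algebra_simps)

lemma three_tangle_hyperdet: "three_tangle \<psi> = 4 * cmod (hyperdet (slice AB \<psi> 0) (slice AB \<psi> 1))"
proof -
  \<comment> \<open>With D the hyperdeterminant, the contraction equals -2 D, so \<open>I5\<close>
    is |D|^2.\<close>
  have "(\<Sum>i1\<in>UNIV. \<Sum>i2\<in>UNIV. \<Sum>i3\<in>UNIV. \<Sum>i4\<in>UNIV.
      \<Sum>j1\<in>UNIV. \<Sum>j2\<in>UNIV. \<Sum>j3\<in>UNIV. \<Sum>j4\<in>UNIV.
      \<Sum>k1\<in>UNIV. \<Sum>k2\<in>UNIV. \<Sum>k3\<in>UNIV. \<Sum>k4\<in>UNIV.
        eps i1 i2 * eps i3 i4 * eps j1 j2 * eps j3 j4 * eps k1 k3 * eps k2 k4 *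
        \<psi> $ (i1, j1, k1) * \<psi> $ (i2, j2, k2) * \<psi> $ (i3, j3, k3) * \<psi> $ (i4, j4, k4))
    = - 2 * hyperdet (slice AB \<psi> 0) (slice AB \<psi> 1)"
    by (simp add: sum_2' eps_def hyperdet_def polar_def det2_def power2_eq_square algebra_simps)
  then show ?thesis
    by (simp add: three_tangle_def I5_def norm_mult power_mult_distrib)
qed

lemma mu0_minus_mu2: "mu0 p \<psi> - mu2 p \<psi> = three_tangle \<psi>"
  unfolding mu0_def mu2_def eigenvalues_Gamma three_tangle_hyperdet
  by (simp add: hyperdet_slice[of p] max_def min_def)

theorem mainTheorem3:
  fixes \<psi> :: three_qubit
  assumes "norm \<psi> = 1"
  shows "(\<forall>p. mu0 p \<psi> - mu2 p \<psi> = three_tangle \<psi>) \<and>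
    (\<forall>p q. mu0 p \<psi> - mu2 p \<psi> = mu0 q \<psi> - mu2 q \<psi>) \<and>
    (\<forall>(l :: nat \<Rightarrow> real) (\<phi> :: real).
       (\<forall>k\<le>4. 0 \<le> l k) \<longrightarrow> (\<Sum>k\<le>4. (l k)\<^sup>2) = 1 \<longrightarrow> 0 \<le> \<phi> \<longrightarrow> \<phi> \<le> pi \<longrightarrow>
       \<psi> = complex_of_real (l 0) *s ket 0 0 0
         + (complex_of_real (l 1) * exp (\<i> * complex_of_real \<phi>)) *s ket 1 0 0
         + complex_of_real (l 2) *s ket 1 0 1
         + complex_of_real (l 3) *s ket 1 1 0
         + complex_of_real (l 4) *s ket 1 1 1 \<longrightarrow>
       (\<forall>p. mu0 p \<psi> - mu2 p \<psi> = 4 * (l 0)\<^sup>2 * (l 4)\<^sup>2))"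
proof -
  have "three_tangle \<psi> = 4 * (l 0)\<^sup>2 * (l 4)\<^sup>2"
    if "\<psi> = complex_of_real (l 0) *s ket 0 0 0
         + (complex_of_real (l 1) * exp (\<i> * complex_of_real \<phi>)) *s ket 1 0 0
         + complex_of_real (l 2) *s ket 1 0 1
         + complex_of_real (l 3) *s ket 1 1 0
         + complex_of_real (l 4) *s ket 1 1 1" for l :: "nat \<Rightarrow> real" and \<phi>
  proof -
    \<comment> \<open>The first row of slice 1 vanishes, so its determinant is 0; slice 0 has first
      row (l 0, 0), so the polar form reduces to l 0 * l 4.\<close>
    have "hyperdet (slice AB \<psi> 0) (slice AB \<psi> 1) = (of_real (l 0) * of_real (l 4))\<^sup>2"
      by (simp add: that hyperdet_def polar_def det2_def ket_def axis_def)
    then show ?thesis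
      by (simp add: three_tangle_hyperdet norm_mult norm_power power_mult_distrib)
  qed
  then show ?thesis
    by (simp add: mu0_minus_mu2)
qed

end
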